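(* Let $A$ be a Büchi alternating automaton on $k$-ary $\Sigma(x,N_P,N_{cF})$-trees and let $t$ be a $k$-ary $\Sigma(x,N_P,N_{cF})$-tree. If $t$ is accepted by $A$, then there exists an accepting uniform run of $A$ on $t$.
   Context: **Concrete domain.** $x$ is a $p$-ary spatial relation algebra: it has a finite set of atoms, which are jointly exhaustive and pairwise disjoint $p$-ary relations on a set $\Delta_{D_x}$ of spatial objects; an $x$ relation is a set of atoms, interpreted as their union; satisfiability of finite conjunctions of atomic constraints is decidable. (Examples: RCC8 over regions of a topological space, the cardinal direction algebra over 2D points, the ternary algebra $CYC_t$ over 2D orientations.) **Alphabets.** $K=\{d_1,\dots,d_k\}$, $k\ge 1$, is a set of directions; $N_P$ is a set of primitive concepts (atomic propositions); $N_{cF}$ is a finite set of concrete features. $\Theta(N_{cF},\Delta_{D_x})$ is the set of total functions $N_{cF}\to\Delta_{D_x}$, and $\Sigma(x,N_P,N_{cF})=2^{N_P}\times\Theta(N_{cF},\Delta_{D_x})$. $Lit(N_P)=N_P\cup\{\neg A: A\in N_P\}$; $c(2^{Lit(N_P)})$ is the set of $S\subseteq Lit(N_P)$ containing no pair $\{A,\neg A\}$. $Constr(x,K,N_{cF})$ is the set of constraints $P(u_1,\dots,u_p)$ with $P$ an $x$ relation and each $u_i\in K^*N_{cF}$ (a finite word of directions followed by a concrete feature). **Trees.** A $k$-ary $\Sigma$-tree is a map $t:K^*\to\Sigma$; a partial $k$-ary $\Sigma$-tree is a partial map $K^*\to\Sigma$ with prefix-closed domain. The root is $\epsilon$, and $ud$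 is the $d$-successor of $u$. The level of a node is its length. If $t$ is a $\Sigma(x,N_P,N_{cF})$-tree, write $t(u)=(P_u,\theta_u)$. **Alternating automaton.** $\mathcal L(S)$ denotes the free distributive lattice generated by $S$ (formulas built from elements of $S$ with $\wedge,\vee$, without negation). A Büchi alternating automaton on $k$-ary $\Sigma(x,N_P,N_{cF})$-trees consists of a finite set $Q$ of states, an initial state $q_0\in Q$, a set $F\subseteq Q$ of accepting states, and a transition function $\delta:Q\to\mathcal L(Lit(N_P)\cup Constr(x,K,N_{cF})\cup (K\times Q))$. Each $\delta(q)$ is supposed to be given in disjunctive normal form. **Histories.** $H_n=\{q_0\}(KQ)^n$ is the set of $n$-histories $h=q_0d_{i_1}q_{i_1}\cdots d_{i_n}q_{i_n}$; $Last(h)$ is $q_0$ if $n=0$ and $q_{i_n}$ otherwise. $H_{fin}=\bigcup_n H_n$. For $h\in H_{fin}$ and $e_1\in\mathcal L(Lit(N_P)\cup Constr(x,K,N_{cF})\cup(K\times Q))$, $dist(h,e_1)$ is obtained from $e_1$ by replacing each generator $(d,q)$ by the history $hdq$, leaving literals and constraints unchanged and commuting with $\vee,\wedge$. **Run.** A run of $A$ on $t$ is a partial $k$-ary tree $\sigma$ labelled in $2^{H_{fin}}\times c(2^{Lit(N_P)})\times 2^{Constr(x,K,N_{cF})}$, with labels written $(Y_u,L_u,X_u)$, such that $Y_\epsilon=\{q_0\}$ and, for each node $u$ of level $n$, putting $e=\bigwedge_{h\in Y_u}dist(h,\delta(Last(h)))$ and writing $e$ in disjunctive normal form as $\bigvee_{i=1}^r(L_i\wedge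 X_i\wedge Y_i)$ ($L_i$ a conjunction of literals, $X_i$ of constraints, $Y_i$ of $(n+1)$-histories), there is $i$ such that: (1) $L_u$ is the set of literals occurring in $L_i$; (2) $X_u$ is the set of constraints occurring in $X_i$; (3) $u$ has a $d$-successor exactly for those $d\in K$ for which the set of $hdq\in H_{n+1}$ ($h\in H_n$, $q\in Q$) occurring in $Y_i$ is nonempty, and $Y_{ud}$ is then that set; (4) for all $A'\in N_P$, $A'\in L_u$ implies $A'\in P_u$ and $\neg A'\in L_u$ implies $A'\notin P_u$; and for every $P(w_1g_1,\dots,w_pg_p)\in X_u$ ($w_i\in K^*$, $g_i\in N_{cF}$), $P(\theta_{uw_1}(g_1),\dots,\theta_{uw_p}(g_p))$ holds. A run of $A$ is a run of $A$ on some $t$. **Uniform run.** A run $\sigma$ of $A$ is uniform if for every node $u$ of $\sigma$, of level $n$, and every $q\in Q$ there is a disjunct $\delta(q,\sigma,u)$ of $\delta(q)$ such that, writing $\bigwedge_{h\in Y_u}dist(h,\delta(Last(h),\sigma,u))=L\wedge X\wedge Y$ ($L$, $X$, $Y$ conjunctions of literals, constraints and $(n+1)$-histories respectively), $L_u$ is the set of literals occurring in $L$, $X_u$ is the set of constraints occurring in $X$, and $u$ has a $d$-successor exactly for those $d\in K$ for which the set of $hdq$ occurring in $Y$ is nonempty, in which case $Y_{ud}$ is that set. **Acceptance.** The CSP of a run $\sigma$ has, for each node $v$ and each $P(w_1g_1,\dots,w_pg_p)\in X_v$, the variables $\langle vw_i,g_i\rangle$ and the constraint $P(\langle vw_1,g_1\rangle,\dots,\langle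 vw_p,g_p\rangle)$; it is consistent if there is an assignment of elements of $\Delta_{D_x}$ to its variables satisfying all its constraints. A branch of $\sigma$ is an infinite path from the root. An infinite history $h=q_0d_{i_1}q_{i_1}d_{i_2}q_{i_2}\cdots$ lies along a branch $\beta$ if for every $n\geq 1$ its $n$-history prefix belongs to $Y_u$, $u$ being the node of $\beta$ of level $n$. It is accepting if some state of $F$ occurs infinitely often in $q_0q_{i_1}q_{i_2}\cdots$. A branch is accepting if every history lying along it is accepting. A run is accepting if all its branches are accepting and its CSP is consistent. $A$ accepts $t$ if there is an accepting run of $A$ on $t$. *)

theory Defs
  imports Main "HOL-Library.FuncSet" "HOL-Library.Nat_Bijection" "HOL-Library.Sublist"
begin

section \<open>Decidable sets of natural numbers\<close>

text \<open>Partial recursive functions; \<open>computes f xs y\<close> is the graph of \<open>f\<close>.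
  They are only used to state decidability of the constraint satisfaction problem
  of a spatial relation algebra.\<close>

datatype recfn =
    Zero
  | Succ
  | Proj nat
  | Comp recfn "recfn list"
  | PrimRec recfn recfn
  | Mu recfn

inductive computes :: "recfn \<Rightarrow> nat list \<Rightarrow> nat \<Rightarrow> bool" where
  zero: "computes Zero xs 0"
| succ: "computes Succ (x # xs) (Suc x)"
| proj: "i < length xs \<Longrightarrow> computes (Proj i) xs (xs ! i)"
| comp: "list_all2 (\<lambda>g y. computes g xs y) gs ys \<Longrightarrow> computes f ys z \<Longrightarrow> computes (Comp f gs) xs z"
| prec_0: "computes f xs y \<Longrightarrow> computes (PrimRec f g) (0 # xs) y"
| prec_Suc: "computes (PrimRec f g) (n # xs) y \<Longrightarrow> computes g (n # y # xs) z \<Longrightarrow>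
    computes (PrimRec f g) (Suc n # xs) z"
| mu: "computes f (n # xs) 0 \<Longrightarrow> \<forall>m<n. \<exists>y. computes f (m # xs) (Suc y) \<Longrightarrow> computes (Mu f) xs n"

definition decidable_set :: "nat set \<Rightarrow> bool" where
  "decidable_set S \<longleftrightarrow> (\<exists>f. \<forall>n. computes f [n] (if n \<in> S then 1 else 0))"

section \<open>Spatial relation algebras\<close>

text \<open>A relation on the objects is a set of lists whose common length is the arity.
  Atoms are relations; a relation of the algebra is a set of atoms, read as its union.\<close>

record 'o spatial_alg =
  objs :: "'o set"
  arity :: nat
  atoms :: "'o list set set"

definition tuples :: "'o spatial_alg \<Rightarrow> 'o list set" where
  "tuples x = {os. length os = arity x \<and> set os \<subseteq> objs x}"

text \<open>A finite conjunction of atomic constraints is a list of pairs \<open>(i, vs)\<close>: the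
  \<open>i\<close>-th atom of a fixed enumeration \<open>as\<close> applied to the variables \<open>vs\<close> (named by numbers).\<close>

definition atomic_conj :: "'o spatial_alg \<Rightarrow> 'o list set list \<Rightarrow> (nat \<times> nat list) list \<Rightarrow> bool" where
  "atomic_conj x as cs \<longleftrightarrow> (\<forall>(i, vs) \<in> set cs. i < length as \<and> length vs = arity x)"

definition atomic_conj_sat :: "'o spatial_alg \<Rightarrow> 'o list set list \<Rightarrow> (nat \<times> nat list) list \<Rightarrow> bool" where
  "atomic_conj_sat x as cs \<longleftrightarrow>
     (\<exists>\<rho>. (\<forall>(i, vs) \<in> set cs. \<rho> ` set vs \<subseteq> objs x \<and> map \<rho> vs \<in> as ! i))"

definition code_conj :: "(nat \<times> nat list) list \<Rightarrow> nat" where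
  "code_conj cs = list_encode (map (\<lambda>(i, vs). prod_encode (i, list_encode vs)) cs)"

definition decidable_atomic_sat :: "'o spatial_alg \<Rightarrow> bool" where
  "decidable_atomic_sat x \<longleftrightarrow>
     (\<exists>as. distinct as \<and> set as = atoms x \<and>
        decidable_set (code_conj ` {cs. atomic_conj x as cs \<and> atomic_conj_sat x as cs}))"

definition spatial_relation_algebra :: "'o spatial_alg \<Rightarrow> bool" where
  "spatial_relation_algebra x \<longleftrightarrow>
     finite (atoms x) \<and> \<Union>(atoms x) = tuples x \<and> pairwise disjnt (atoms x) \<and>
     decidable_atomic_sat x"

section \<open>Literals, constraints and trees\<close>

text \<open>The set \<open>K\<close> of directions is the universe of a finite type \<open>'d\<close> (so \<open>k \<ge> 1\<close>), words over
  \<open>K\<close> are lists, and the \<open>d\<close>-successor of \<open>u\<close> is \<open>u @ [d]\<close>. The primitive concepts \<open>NP\<close> and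
  the concrete features \<open>NF\<close> are explicit sets, which may be empty.\<close>

datatype 'a literal = Pos 'a | Neg 'a

definition Lit_of :: "'a set \<Rightarrow> 'a literal set" where
  "Lit_of NP = Pos ` NP \<union> Neg ` NP"

definition consistent_lits :: "'a set \<Rightarrow> 'a literal set set" where
  "consistent_lits NP = {S. S \<subseteq> Lit_of NP \<and> \<not> (\<exists>a. Pos a \<in> S \<and> Neg a \<in> S)}"

datatype ('o, 'd, 'g) constr = Constr "'o list set set" "('d list \<times> 'g) list"

definition Constr_of :: "'o spatial_alg \<Rightarrow> 'g set \<Rightarrow> ('o, 'd, 'g) constr set" where
  "Constr_of x NF =
     {Constr P us | P us. P \<subseteq> atoms x \<and> length us = arity x \<and> snd ` set us \<subseteq> NF}"

type_synonym ('d, 'a, 'g, 'o) sigma_tree = "'d list \<Rightarrow> 'a set \<times> ('g \<Rightarrow> 'o)"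

definition is_sigma_tree ::
    "'o spatial_alg \<Rightarrow> 'a set \<Rightarrow> 'g set \<Rightarrow> ('d, 'a, 'g, 'o) sigma_tree \<Rightarrow> bool" where
  "is_sigma_tree x NP NF t \<longleftrightarrow> (\<forall>u. t u \<in> Pow NP \<times> (NF \<rightarrow>\<^sub>E objs x))"

fun lit_holds :: "('d, 'a, 'g, 'o) sigma_tree \<Rightarrow> 'd list \<Rightarrow> 'a literal \<Rightarrow> bool" where
  "lit_holds t u (Pos a) \<longleftrightarrow> a \<in> fst (t u)"
| "lit_holds t u (Neg a) \<longleftrightarrow> a \<notin> fst (t u)"

fun constr_holds :: "('d, 'a, 'g, 'o) sigma_tree \<Rightarrow> 'd list \<Rightarrow> ('o, 'd, 'g) constr \<Rightarrow> bool" where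
  "constr_holds t u (Constr P us) \<longleftrightarrow> map (\<lambda>(w, g). snd (t (u @ w)) g) us \<in> \<Union>P"

section \<open>Positive formulas\<close>

text \<open>\<open>L(S)\<close> is rendered by the formulas all of whose generators lie in \<open>S\<close>. There are no
  constants for truth and falsity, so a disjunctive normal form is a nonempty disjunction of
  nonempty conjunctions of generators.\<close>

datatype 'b fm = Gen 'b | And "'b fm" "'b fm" | Or "'b fm" "'b fm"

abbreviation generators :: "'b fm \<Rightarrow> 'b set" where
  "generators \<equiv> set_fm"

fun is_conj :: "'b fm \<Rightarrow> bool" where
  "is_conj (Gen b) = True"
| "is_conj (And e1 e2) \<longleftrightarrow> is_conj e1 \<and> is_conj e2"
| "is_conj (Or e1 e2) = False"

fun disjuncts :: "'b fm \<Rightarrow> 'b fm set" where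
  "disjuncts (Or e1 e2) = disjuncts e1 \<union> disjuncts e2"
| "disjuncts e = {e}"

definition is_dnf :: "'b fm \<Rightarrow> bool" where
  "is_dnf e \<longleftrightarrow> (\<forall>c \<in> disjuncts e. is_conj c)"

text \<open>The disjunctive normal form obtained by distributing conjunction over disjunction
  (without absorption).\<close>

fun distr :: "'b fm \<Rightarrow> 'b fm \<Rightarrow> 'b fm" where
  "distr (Or a b) c = Or (distr a c) (distr b c)"
| "distr a (Or b c) = Or (distr a b) (distr a c)"
| "distr a b = And a b"

fun dnf :: "'b fm \<Rightarrow> 'b fm" where
  "dnf (Gen b) = Gen b"
| "dnf (Or e1 e2) = Or (dnf e1) (dnf e2)"
| "dnf (And e1 e2) = distr (dnf e1) (dnf e2)"

lemma disjuncts_distr: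
  "disjuncts (distr a b) = (\<lambda>(c, d). And c d) ` (disjuncts a \<times> disjuncts b)"
  by (induction a b rule: distr.induct) (auto simp: image_iff)

lemma is_dnf_dnf: "is_dnf (dnf e)"
  by (induction e) (auto simp: is_dnf_def disjuncts_distr)

fun sat_fm :: "('b \<Rightarrow> bool) \<Rightarrow> 'b fm \<Rightarrow> bool" where
  "sat_fm v (Gen b) = v b"
| "sat_fm v (And e1 e2) \<longleftrightarrow> sat_fm v e1 \<and> sat_fm v e2"
| "sat_fm v (Or e1 e2) \<longleftrightarrow> sat_fm v e1 \<or> sat_fm v e2"

lemma sat_distr: "sat_fm v (distr a b) \<longleftrightarrow> sat_fm v a \<and> sat_fm v b"
  by (induction a b rule: distr.induct) auto

lemma sat_dnf: "sat_fm v (dnf e) \<longleftrightarrow> sat_fm v e"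
  by (induction e) (auto simp: sat_distr)

fun And_list :: "'b fm list \<Rightarrow> 'b fm" where
  "And_list [e] = e"
| "And_list (e # f # es) = And e (And_list (f # es))"

text \<open>\<open>e\<close> is the conjunction of the \<open>\<phi> h\<close> for \<open>h \<in> Y\<close>, written out in some order of the
  (finite, nonempty) set \<open>Y\<close>. The order affects neither the generators of \<open>e\<close> nor those
  of the disjuncts of \<open>dnf e\<close>.\<close>

definition is_conj_over :: "'h set \<Rightarrow> ('h \<Rightarrow> 'b fm) \<Rightarrow> 'b fm \<Rightarrow> bool" where
  "is_conj_over Y \<phi> e \<longleftrightarrow>
     (\<exists>hs. hs \<noteq> [] \<and> distinct hs \<and> set hs = Y \<and> e = And_list (map \<phi> hs))"

section \<open>Alternating automata and histories\<close>

text \<open>The last kind of generator is a move in \<open>K \<times> Q\<close> for transition formulas, and a history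
  after applying \<open>dist\<close>.\<close>

datatype ('a, 'o, 'd, 'g, 'm) gen = GLit "'a literal" | GCon "('o, 'd, 'g) constr" | GMove 'm

text \<open>The finite set of states is the universe of a finite type \<open>'q\<close>.\<close>

record ('q, 'd, 'a, 'o, 'g) automaton =
  init :: 'q
  accepting_states :: "'q set"
  delta :: "'q \<Rightarrow> ('a, 'o, 'd, 'g, 'd \<times> 'q) gen fm"

definition is_automaton ::
    "'o spatial_alg \<Rightarrow> 'a set \<Rightarrow> 'g set \<Rightarrow> ('q::finite, 'd::finite, 'a, 'o, 'g) automaton \<Rightarrow> bool" where
  "is_automaton x NP NF A \<longleftrightarrow>
     (\<forall>q. is_dnf (delta A q) \<and>
          generators (delta A q) \<subseteq> GLit ` Lit_of NP \<union> GCon ` Constr_of x NF \<union> range GMove)"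

text \<open>The history \<open>q\<^sub>0 d\<^sub>1 q\<^sub>1 \<dots> d\<^sub>n q\<^sub>n\<close> is \<open>(q\<^sub>0, [(d\<^sub>1, q\<^sub>1), \<dots>, (d\<^sub>n, q\<^sub>n)])\<close>.\<close>

type_synonym ('q, 'd) history = "'q \<times> ('d \<times> 'q) list"

definition Hist :: "('q, 'd, 'a, 'o, 'g) automaton \<Rightarrow> nat \<Rightarrow> ('q, 'd) history set" where
  "Hist A n = {init A} \<times> {w. length w = n}"

definition Hist_fin :: "('q, 'd, 'a, 'o, 'g) automaton \<Rightarrow> ('q, 'd) history set" where
  "Hist_fin A = (\<Union>n. Hist A n)"

definition Last :: "('q, 'd) history \<Rightarrow> 'q" where
  "Last h = (if snd h = [] then fst h else snd (last (snd h)))"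

definition snoc_hist :: "('q, 'd) history \<Rightarrow> 'd \<Rightarrow> 'q \<Rightarrow> ('q, 'd) history" where
  "snoc_hist h d q = (fst h, snd h @ [(d, q)])"

fun dist_gen :: "('q, 'd) history \<Rightarrow> ('a, 'o, 'd, 'g, 'd \<times> 'q) gen \<Rightarrow>
    ('a, 'o, 'd, 'g, ('q, 'd) history) gen" where
  "dist_gen h (GLit l) = GLit l"
| "dist_gen h (GCon c) = GCon c"
| "dist_gen h (GMove (d, q)) = GMove (snoc_hist h d q)"

definition dist :: "('q, 'd) history \<Rightarrow> ('a, 'o, 'd, 'g, 'd \<times> 'q) gen fm \<Rightarrow>
    ('a, 'o, 'd, 'g, ('q, 'd) history) gen fm" where
  "dist h e = map_fm (dist_gen h) e"

section \<open>Runs\<close>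

record ('q, 'd, 'a, 'o, 'g) run_label =
  hists :: "('q, 'd) history set"
  lits :: "'a literal set"
  constrs :: "('o, 'd, 'g) constr set"

type_synonym ('q, 'd, 'a, 'o, 'g) run_tree = "'d list \<rightharpoonup> ('q, 'd, 'a, 'o, 'g) run_label"

definition Y_of :: "('q, 'd, 'a, 'o, 'g) run_tree \<Rightarrow> 'd list \<Rightarrow> ('q, 'd) history set" where
  "Y_of \<sigma> u = hists (the (\<sigma> u))"

definition L_of :: "('q, 'd, 'a, 'o, 'g) run_tree \<Rightarrow> 'd list \<Rightarrow> 'a literal set" where
  "L_of \<sigma> u = lits (the (\<sigma> u))"

definition X_of :: "('q, 'd, 'a, 'o, 'g) run_tree \<Rightarrow> 'd list \<Rightarrow> ('o, 'd, 'g) constr set" where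
  "X_of \<sigma> u = constrs (the (\<sigma> u))"

definition is_partial_tree :: "('d list \<rightharpoonup> 'l) \<Rightarrow> bool" where
  "is_partial_tree \<sigma> \<longleftrightarrow> (\<forall>v \<in> dom \<sigma>. \<forall>u. prefix u v \<longrightarrow> u \<in> dom \<sigma>)"

definition is_run_labelling :: "'o spatial_alg \<Rightarrow> 'a set \<Rightarrow> 'g set \<Rightarrow>
    ('q, 'd, 'a, 'o, 'g) automaton \<Rightarrow> ('q, 'd, 'a, 'o, 'g) run_tree \<Rightarrow> bool" where
  "is_run_labelling x NP NF A \<sigma> \<longleftrightarrow>
     (\<forall>u \<in> dom \<sigma>. Y_of \<sigma> u \<subseteq> Hist_fin A \<and> L_of \<sigma> u \<in> consistent_lits NP \<and>
        X_of \<sigma> u \<subseteq> Constr_of x NF)"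

text \<open>The \<open>(n+1)\<close>-histories with last direction \<open>d\<close> occurring in a set \<open>C\<close> of generators.\<close>

definition succ_hists :: "('q, 'd, 'a, 'o, 'g) automaton \<Rightarrow> nat \<Rightarrow>
    ('a, 'o, 'd, 'g, ('q, 'd) history) gen set \<Rightarrow> 'd \<Rightarrow> ('q, 'd) history set" where
  "succ_hists A n C d = {snoc_hist h d q | h q. h \<in> Hist A n \<and> GMove (snoc_hist h d q) \<in> C}"

text \<open>The label of \<open>u\<close> and its successors are those prescribed by a conjunction
  \<open>L \<and> X \<and> Y\<close> with set of generators \<open>C\<close>.\<close>

definition node_follows :: "('q, 'd, 'a, 'o, 'g) automaton \<Rightarrow> ('q, 'd, 'a, 'o, 'g) run_tree \<Rightarrow>
    'd list \<Rightarrow> ('a, 'o, 'd, 'g, ('q, 'd) history) gen set \<Rightarrow> bool" where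
  "node_follows A \<sigma> u C \<longleftrightarrow>
     L_of \<sigma> u = {l. GLit l \<in> C} \<and>
     X_of \<sigma> u = {c. GCon c \<in> C} \<and>
     (\<forall>d. (u @ [d] \<in> dom \<sigma> \<longleftrightarrow> succ_hists A (length u) C d \<noteq> {}) \<and>
          (u @ [d] \<in> dom \<sigma> \<longrightarrow> Y_of \<sigma> (u @ [d]) = succ_hists A (length u) C d))"

definition is_run_on :: "'o spatial_alg \<Rightarrow> 'a set \<Rightarrow> 'g set \<Rightarrow>
    ('q::finite, 'd::finite, 'a, 'o, 'g) automaton \<Rightarrow> ('d, 'a, 'g, 'o) sigma_tree \<Rightarrow>
    ('q, 'd, 'a, 'o, 'g) run_tree \<Rightarrow> bool" where
  "is_run_on x NP NF A t \<sigma> \<longleftrightarrow>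
     is_partial_tree \<sigma> \<and> is_run_labelling x NP NF A \<sigma> \<and>
     [] \<in> dom \<sigma> \<and> Y_of \<sigma> [] = {(init A, [])} \<and>
     (\<forall>u \<in> dom \<sigma>.
        (\<exists>e. is_conj_over (Y_of \<sigma> u) (\<lambda>h. dist h (delta A (Last h))) e \<and>
             (\<exists>c \<in> disjuncts (dnf e). node_follows A \<sigma> u (generators c))) \<and>
        (\<forall>l \<in> L_of \<sigma> u. lit_holds t u l) \<and>
        (\<forall>c \<in> X_of \<sigma> u. constr_holds t u c))"

definition is_run :: "'o spatial_alg \<Rightarrow> 'a set \<Rightarrow> 'g set \<Rightarrow>
    ('q::finite, 'd::finite, 'a, 'o, 'g) automaton \<Rightarrow> ('q, 'd, 'a, 'o, 'g) run_tree \<Rightarrow> bool" where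
  "is_run x NP NF A \<sigma> \<longleftrightarrow> (\<exists>t. is_sigma_tree x NP NF t \<and> is_run_on x NP NF A t \<sigma>)"

text \<open>\<open>D q\<close> plays the role of \<open>\<delta>(q, \<sigma>, u)\<close>; it depends on the state only, and not on the history.\<close>

definition is_uniform_run :: "'o spatial_alg \<Rightarrow> 'a set \<Rightarrow> 'g set \<Rightarrow>
    ('q::finite, 'd::finite, 'a, 'o, 'g) automaton \<Rightarrow> ('q, 'd, 'a, 'o, 'g) run_tree \<Rightarrow> bool" where
  "is_uniform_run x NP NF A \<sigma> \<longleftrightarrow>
     is_run x NP NF A \<sigma> \<and>
     (\<forall>u \<in> dom \<sigma>. \<exists>D. (\<forall>q. D q \<in> disjuncts (delta A q)) \<and>
        (\<exists>e. is_conj_over (Y_of \<sigma> u) (\<lambda>h. dist h (D (Last h))) e \<and>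
             node_follows A \<sigma> u (generators e)))"

section \<open>Acceptance\<close>

definition shift_vars :: "'d list \<Rightarrow> ('d list \<times> 'g) list \<Rightarrow> ('d list \<times> 'g) list" where
  "shift_vars v us = map (\<lambda>(w, g). (v @ w, g)) us"

text \<open>Constraints of the CSP of a run; the variable \<open>\<langle>u, g\<rangle>\<close> is the pair \<open>(u, g)\<close>.\<close>

definition csp :: "('q, 'd, 'a, 'o, 'g) run_tree \<Rightarrow> ('o list set set \<times> ('d list \<times> 'g) list) set" where
  "csp \<sigma> = {(P, shift_vars v us) | P us v. v \<in> dom \<sigma> \<and> Constr P us \<in> X_of \<sigma> v}"

definition csp_consistent :: "'o spatial_alg \<Rightarrow> ('q, 'd, 'a, 'o, 'g) run_tree \<Rightarrow> bool" where
  "csp_consistent x \<sigma> \<longleftrightarrow>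
     (\<exists>\<rho>. \<forall>(P, vs) \<in> csp \<sigma>. \<rho> ` set vs \<subseteq> objs x \<and> map \<rho> vs \<in> \<Union>P)"

text \<open>A branch is given by its infinite sequence of directions; \<open>node_at \<beta> n\<close> is its node
  of level \<open>n\<close>.\<close>

definition node_at :: "(nat \<Rightarrow> 'd) \<Rightarrow> nat \<Rightarrow> 'd list" where
  "node_at \<beta> n = map \<beta> [0..<n]"

definition is_branch :: "('q, 'd, 'a, 'o, 'g) run_tree \<Rightarrow> (nat \<Rightarrow> 'd) \<Rightarrow> bool" where
  "is_branch \<sigma> \<beta> \<longleftrightarrow> (\<forall>n. node_at \<beta> n \<in> dom \<sigma>)"

text \<open>An infinite history \<open>q\<^sub>0 d\<^sub>1 q\<^sub>1 d\<^sub>2 q\<^sub>2 \<dots>\<close> is given by \<open>\<eta>\<close> with \<open>\<eta> n = (d\<^bsub>n+1\<^esub>, q\<^bsub>n+1\<^esub>)\<close>.\<close>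

definition hist_prefix :: "('q, 'd, 'a, 'o, 'g) automaton \<Rightarrow> (nat \<Rightarrow> 'd \<times> 'q) \<Rightarrow> nat \<Rightarrow> ('q, 'd) history" where
  "hist_prefix A \<eta> n = (init A, map \<eta> [0..<n])"

definition hist_along :: "('q, 'd, 'a, 'o, 'g) automaton \<Rightarrow> ('q, 'd, 'a, 'o, 'g) run_tree \<Rightarrow>
    (nat \<Rightarrow> 'd) \<Rightarrow> (nat \<Rightarrow> 'd \<times> 'q) \<Rightarrow> bool" where
  "hist_along A \<sigma> \<beta> \<eta> \<longleftrightarrow> (\<forall>n\<ge>1. hist_prefix A \<eta> n \<in> Y_of \<sigma> (node_at \<beta> n))"

definition hist_accepting :: "('q, 'd, 'a, 'o, 'g) automaton \<Rightarrow> (nat \<Rightarrow> 'd \<times> 'q) \<Rightarrow> bool" where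
  "hist_accepting A \<eta> \<longleftrightarrow>
     (\<exists>q \<in> accepting_states A. infinite {n. Last (hist_prefix A \<eta> n) = q})"

definition is_accepting :: "'o spatial_alg \<Rightarrow> ('q, 'd, 'a, 'o, 'g) automaton \<Rightarrow>
    ('q, 'd, 'a, 'o, 'g) run_tree \<Rightarrow> bool" where
  "is_accepting x A \<sigma> \<longleftrightarrow>
     (\<forall>\<beta>. is_branch \<sigma> \<beta> \<longrightarrow> (\<forall>\<eta>. hist_along A \<sigma> \<beta> \<eta> \<longrightarrow> hist_accepting A \<eta>)) \<and>
     csp_consistent x \<sigma>"

definition accepts :: "'o spatial_alg \<Rightarrow> 'a set \<Rightarrow> 'g set \<Rightarrow>
    ('q::finite, 'd::finite, 'a, 'o, 'g) automaton \<Rightarrow> ('d, 'a, 'g, 'o) sigma_tree \<Rightarrow> bool" where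
  "accepts x NP NF A t \<longleftrightarrow> (\<exists>\<sigma>. is_run_on x NP NF A t \<sigma> \<and> is_accepting x A \<sigma>)"

end

(* Read an accepting run as a history-dependent winning strategy in the acceptance game on
   positions (u, q), with u a node and q a state. On the set W of positions occurring in the run,
   let the rank of a position be the number of moves needed to force a visit to an accepting state
   without leaving W; a position of W without rank would yield a history of the run that avoids
   accepting states from some point on. Choosing at every position a disjunct that lowers the
   rank until an accepting state is met depends on (u, q) only, and the histories compatible with
   these choices form the uniform run. Consistency of the CSP is witnessed by the tree itself. *)
theory Submission
  imports Defs "HOL-Library.Infinite_Set"
begin

section \<open>Normal forms of conjunctions as choices of one disjunct per conjunct\<close>

section \<open>Disjunctive normal forms\<close>

lemma distr_is_conj: "is_conj a \<Longrightarrow> is_conj b \<Longrightarrow> distr a b = And a b"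
  by (cases a; cases b) auto

lemma dnf_is_conj: "is_conj e \<Longrightarrow> dnf e = e"
  by (induction e) (auto simp: distr_is_conj)

text \<open>A conjunction in normal form is its own only disjunct, so it contains no
  \<open>Or\<close> to distribute over. Hence the disjuncts of \<open>delta A q\<close> are
  themselves the options of a run.\<close>

lemma dnf_is_dnf: "is_dnf e \<Longrightarrow> dnf e = e"
proof (induction e)
  case (And e1 e2)
  then have "is_conj (And e1 e2)" by (simp add: is_dnf_def)
  then show ?case by (rule dnf_is_conj)
qed (auto simp: is_dnf_def)

lemma disjuncts_nonempty: "disjuncts e \<noteq> {}"
  by (induction e) auto

lemma generators_disjunct: "c \<in> disjuncts e \<Longrightarrow> generators c \<subseteq> generators e"
  by (induction e) auto

lemma disjuncts_map_fm: "disjuncts (map_fm f e) = map_fm f ` disjuncts e"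
  by (induction e) auto

lemma is_conj_map_fm: "is_conj (map_fm f e) = is_conj e"
  by (induction e) auto

lemma is_dnf_map_fm: "is_dnf (map_fm f e) = is_dnf e"
  by (auto simp: is_dnf_def disjuncts_map_fm is_conj_map_fm)

lemma finite_generators: "finite (generators e)"
  by (induction e) auto

lemma generators_dist: "generators (dist h e) = dist_gen h ` generators e"
  by (simp add: dist_def fm.set_map)

lemma generators_And_list: "es \<noteq> [] \<Longrightarrow> generators (And_list es) = (\<Union>e\<in>set es. generators e)"
  by (induction es rule: And_list.induct) auto

lemma And_list_Cons: "es \<noteq> [] \<Longrightarrow> And_list (e # es) = And e (And_list es)"
  by (cases es) auto

text \<open>Distribution without absorption picks exactly one disjunct from every conjunct.
  Distinctness of \<open>hs\<close> makes the picks a function of \<open>h\<close>.\<close>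

lemma disjunct_dnf_And_listD:
  assumes "hs \<noteq> []" "distinct hs" "c \<in> disjuncts (dnf (And_list (map \<phi> hs)))"
  shows "\<exists>f. (\<forall>h\<in>set hs. f h \<in> disjuncts (dnf (\<phi> h))) \<and>
    generators c = (\<Union>h\<in>set hs. generators (f h))"
  using assms
proof (induction hs arbitrary: c rule: list_nonempty_induct)
  case (single h)
  then show ?case by (intro exI[of _ "\<lambda>_. c"]) auto
next
  case (cons h hs)
  then obtain a b where c: "c = And a b" and a: "a \<in> disjuncts (dnf (\<phi> h))"
    and b: "b \<in> disjuncts (dnf (And_list (map \<phi> hs)))"
    by (auto simp: And_list_Cons disjuncts_distr)
  from cons.IH[OF _ b] cons.prems obtain f where
    f: "\<forall>h\<in>set hs. f h \<in> disjuncts (dnf (\<phi> h))" "generators b = (\<Union>h\<in>set hs. generators (f h))"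
    by auto
  \<comment> \<open>By distinctness, the pick \<open>a\<close> can be recorded at \<open>h\<close>
    without altering the picks for the tail.\<close>
  have "h \<notin> set hs" using cons.prems by simp
  then have "(\<Union>k\<in>set hs. generators ((f(h := a)) k)) = (\<Union>k\<in>set hs. generators (f k))"
    by (intro SUP_cong) auto
  then show ?case using f a c by (intro exI[of _ "f(h := a)"]) auto
qed

text \<open>The converse direction: any family of picks is realised by conjoining them in list
  order.\<close>

lemma disjunct_dnf_And_listI:
  assumes "hs \<noteq> []" "\<forall>h\<in>set hs. f h \<in> disjuncts (dnf (\<phi> h))"
  shows "\<exists>c\<in>disjuncts (dnf (And_list (map \<phi> hs))). generators c = (\<Union>h\<in>set hs. generators (f h))"
  using assms
proof (induction hs rule: list_nonempty_induct)
  case (cons h hs)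
  then obtain b where "b \<in> disjuncts (dnf (And_list (map \<phi> hs)))"
    "generators b = (\<Union>h\<in>set hs. generators (f h))"
    by auto
  then show ?case using cons
    by (intro bexI[of _ "And (f h) b"]) (auto simp: And_list_Cons disjuncts_distr)
qed auto

section \<open>Runs as trees of histories with a disjunct chosen for each history\<close>

section \<open>Runs\<close>

text \<open>The legal options, at position \<open>(u, q)\<close> of the acceptance game, of the
  player who resolves disjunctions.\<close>

definition choice_ok :: "('q, 'd, 'a, 'o, 'g) automaton \<Rightarrow> ('d, 'a, 'g, 'o) sigma_tree \<Rightarrow>
    'd list \<Rightarrow> 'q \<Rightarrow> ('a, 'o, 'd, 'g, 'd \<times> 'q) gen fm \<Rightarrow> bool" where
  "choice_ok A t u q c \<longleftrightarrow> c \<in> disjuncts (delta A q) \<and>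
     (\<forall>l. GLit l \<in> generators c \<longrightarrow> lit_holds t u l) \<and>
     (\<forall>k. GCon k \<in> generators c \<longrightarrow> constr_holds t u k)"

lemma dist_gen_eq_iff [simp]:
  "GLit l = dist_gen h g \<longleftrightarrow> g = GLit l"
  "GCon k = dist_gen h g \<longleftrightarrow> g = GCon k"
  "GMove h' = dist_gen h g \<longleftrightarrow> (\<exists>d q. g = GMove (d, q) \<and> h' = snoc_hist h d q)"
  by (cases "(h, g)" rule: dist_gen.cases; auto)+

lemma snoc_hist_eq_iff [simp]: "snoc_hist h d q = snoc_hist h' d' q' \<longleftrightarrow> h = h' \<and> d = d' \<and> q = q'"
  by (auto simp: snoc_hist_def prod_eq_iff)

lemma Last_snoc [simp]: "Last (q0, w @ [(d, q)]) = q"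
  by (simp add: Last_def)

lemma snoc_hist_Pair [simp]: "snoc_hist (q0, w) d q = (q0, w @ [(d, q)])"
  by (simp add: snoc_hist_def)

text \<open>The histories of a run without their constant initial state. The directions of such a
  word spell the node where it is found, so nodes need no separate bookkeeping.\<close>

definition run_words :: "('q, 'd, 'a, 'o, 'g) automaton \<Rightarrow> ('q, 'd, 'a, 'o, 'g) run_tree \<Rightarrow>
    ('d \<times> 'q) list set" where
  "run_words A \<sigma> = {w. map fst w \<in> dom \<sigma> \<and> (init A, w) \<in> Y_of \<sigma> (map fst w)}"

text \<open>Splits the disjunct used at a node into one disjunct per history. The choice
  \<open>f\<close> may differ on histories with the same last state, which is what uniformity
  forbids.\<close>

lemma run_choice:
  assumes A: "is_automaton x NP NF A" and run: "is_run_on x NP NF A t \<sigma>" and u: "u \<in> dom \<sigma>"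
  obtains f where "\<forall>h\<in>Y_of \<sigma> u. f h \<in> disjuncts (delta A (Last h))"
    "node_follows A \<sigma> u (\<Union>h\<in>Y_of \<sigma> u. dist_gen h ` generators (f h))"
proof -
  have dnf: "is_dnf (delta A q)" for q using A by (simp add: is_automaton_def)
  from run u obtain e c where e: "is_conj_over (Y_of \<sigma> u) (\<lambda>h. dist h (delta A (Last h))) e"
    and c: "c \<in> disjuncts (dnf e)" and nf: "node_follows A \<sigma> u (generators c)"
    unfolding is_run_on_def by blast
  from e obtain hs where hs: "hs \<noteq> []" "distinct hs" "set hs = Y_of \<sigma> u"
    "e = And_list (map (\<lambda>h. dist h (delta A (Last h))) hs)"
    by (auto simp: is_conj_over_def)
  from disjunct_dnf_And_listD[OF hs(1,2)] c hs(4) obtain f where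
    f: "\<forall>h\<in>set hs. f h \<in> disjuncts (dnf (dist h (delta A (Last h))))"
      "generators c = (\<Union>h\<in>set hs. generators (f h))"
    by blast
  have "\<forall>h\<in>set hs. \<exists>g. g \<in> disjuncts (delta A (Last h)) \<and> f h = dist h g"
    using f(1) dnf by (auto simp: dnf_is_dnf is_dnf_map_fm dist_def disjuncts_map_fm)
  then obtain g where g: "\<forall>h\<in>set hs. g h \<in> disjuncts (delta A (Last h)) \<and> f h = dist h (g h)"
    by metis
  show thesis
  proof (rule that[of g])
    show "\<forall>h\<in>Y_of \<sigma> u. g h \<in> disjuncts (delta A (Last h))" using g hs(3) by auto
    have "generators c = (\<Union>h\<in>Y_of \<sigma> u. dist_gen h ` generators (g h))"
      using f(2) g hs(3) by (auto simp: generators_dist)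
    then show "node_follows A \<sigma> u (\<Union>h\<in>Y_of \<sigma> u. dist_gen h ` generators (g h))" using nf by simp
  qed
qed

lemma run_words_Nil: "is_run_on x NP NF A t \<sigma> \<Longrightarrow> [] \<in> run_words A \<sigma>"
  by (auto simp: is_run_on_def run_words_def)

text \<open>A history at a successor stems from a move generator, and \<open>dist_gen\<close>
  creates these only by extending a history of the parent node.\<close>

lemma run_words_butlast:
  assumes A: "is_automaton x NP NF A" and run: "is_run_on x NP NF A t \<sigma>"
    and w: "w @ [(d, q)] \<in> run_words A \<sigma>"
  shows "w \<in> run_words A \<sigma>"
proof -
  let ?u = "map fst w"
  have dom: "?u @ [d] \<in> dom \<sigma>" and Y: "(init A, w @ [(d, q)]) \<in> Y_of \<sigma> (?u @ [d])"
    using w by (auto simp: run_words_def)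
  have u: "?u \<in> dom \<sigma>" using run dom unfolding is_run_on_def is_partial_tree_def
    by (meson prefixI)
  from run_choice[OF A run u] obtain f where
    nf: "node_follows A \<sigma> ?u (\<Union>h\<in>Y_of \<sigma> ?u. dist_gen h ` generators (f h))" .
  then have "(init A, w @ [(d, q)]) \<in>
      succ_hists A (length ?u) (\<Union>h\<in>Y_of \<sigma> ?u. dist_gen h ` generators (f h)) d"
    using Y dom unfolding node_follows_def by blast
  then obtain h where "h \<in> Y_of \<sigma> ?u" "snoc_hist h d q = (init A, w @ [(d, q)])"
    by (auto simp: succ_hists_def image_iff snoc_hist_def)
  then have "(init A, w) \<in> Y_of \<sigma> ?u" by (cases h) (simp add: snoc_hist_def)
  then show ?thesis using u by (simp add: run_words_def)
qed

lemma run_words_append: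
  assumes "is_automaton x NP NF A" "is_run_on x NP NF A t \<sigma>" "v @ w \<in> run_words A \<sigma>"
  shows "v \<in> run_words A \<sigma>"
  using assms(3)
proof (induction w rule: rev_induct)
  case (snoc p w)
  then show ?case using run_words_butlast[OF assms(1,2), of "v @ w" "fst p" "snd p"] by simp
qed simp

text \<open>The disjunct that the run picks for this one history contributes its literals and
  constraints to the label of the node, which \<open>t\<close> satisfies, and its moves to the
  successors.\<close>

lemma run_words_choice:
  assumes A: "is_automaton x NP NF A" and run: "is_run_on x NP NF A t \<sigma>"
    and w: "w \<in> run_words A \<sigma>"
  shows "\<exists>c. choice_ok A t (map fst w) (Last (init A, w)) c \<and>
    (\<forall>d q. GMove (d, q) \<in> generators c \<longrightarrow> w @ [(d, q)] \<in> run_words A \<sigma>)"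
proof -
  let ?u = "map fst w" and ?h = "(init A, w)"
  have u: "?u \<in> dom \<sigma>" and Y: "?h \<in> Y_of \<sigma> ?u" using w by (auto simp: run_words_def)
  from run_choice[OF A run u] obtain f where
    f: "\<forall>h\<in>Y_of \<sigma> ?u. f h \<in> disjuncts (delta A (Last h))"
    and nf: "node_follows A \<sigma> ?u (\<Union>h\<in>Y_of \<sigma> ?u. dist_gen h ` generators (f h))"
      (is "node_follows _ _ _ ?C") .
  have sub: "dist_gen ?h g \<in> ?C" if "g \<in> generators (f ?h)" for g using Y that by blast
  have L: "GLit l \<in> generators (f ?h) \<Longrightarrow> l \<in> L_of \<sigma> ?u" for l
    using nf sub[of "GLit l"] by (simp add: node_follows_def)
  have X: "GCon k \<in> generators (f ?h) \<Longrightarrow> k \<in> X_of \<sigma> ?u" for k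
    using nf sub[of "GCon k"] by (simp add: node_follows_def)
  have M: "w @ [(d, q)] \<in> run_words A \<sigma>" if "GMove (d, q) \<in> generators (f ?h)" for d q
  proof -
    have "GMove (snoc_hist ?h d q) \<in> ?C" using sub[OF that] by simp
    moreover have "?h \<in> Hist A (length ?u)" by (simp add: Hist_def)
    ultimately have "snoc_hist ?h d q \<in> succ_hists A (length ?u) ?C d"
      unfolding succ_hists_def by blast
    then show ?thesis using nf unfolding node_follows_def run_words_def by fastforce
  qed
  have "lit_holds t ?u l" if "l \<in> L_of \<sigma> ?u" for l using run u that by (simp add: is_run_on_def)
  moreover have "constr_holds t ?u k" if "k \<in> X_of \<sigma> ?u" for k
    using run u that by (simp add: is_run_on_def)
  ultimately have "choice_ok A t ?u (Last ?h) (f ?h)" using f Y L X by (simp add: choice_ok_def)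
  then show ?thesis using M by blast
qed

section \<open>Attractor ranks and the extraction of a positional strategy\<close>

section \<open>Positional strategies\<close>

text \<open>The directions of \<open>\<eta>\<close> form a branch of the run, and
  \<open>\<eta>\<close> lies along it.\<close>

lemma run_words_infinite:
  assumes acc: "is_accepting x A \<sigma>" and "\<And>n. map \<eta> [0..<n] \<in> run_words A \<sigma>"
  shows "hist_accepting A \<eta>"
proof -
  have "is_branch \<sigma> (fst \<circ> \<eta>)" "hist_along A \<sigma> (fst \<circ> \<eta>) \<eta>"
    using assms(2) by (auto simp: is_branch_def hist_along_def hist_prefix_def run_words_def
        node_at_def domIff)
  then show ?thesis using acc by (auto simp: is_accepting_def)
qed

text \<open>Pigeonhole: with finitely many states, infinitely many visits to the accepting set give
  infinitely many visits to a single accepting state.\<close>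

lemma hist_accepting_iff:
  fixes A :: "('q::finite, 'd, 'a, 'o, 'g) automaton"
  shows "hist_accepting A \<eta> \<longleftrightarrow> (\<forall>N. \<exists>n\<ge>N. Last (hist_prefix A \<eta> n) \<in> accepting_states A)"
proof -
  have "{n. Last (hist_prefix A \<eta> n) \<in> accepting_states A} =
      (\<Union>q\<in>accepting_states A. {n. Last (hist_prefix A \<eta> n) = q})" by auto
  then have "hist_accepting A \<eta> \<longleftrightarrow> infinite {n. Last (hist_prefix A \<eta> n) \<in> accepting_states A}"
    by (simp add: hist_accepting_def)
  then show ?thesis by (simp add: infinite_nat_iff_unbounded_le)
qed

text \<open>Attractor of the accepting states, with all moves kept inside \<open>W\<close>.
  Acceptance is tested at successors only, so an accepting position must itself force a further
  visit; a disjunct without moves puts its position into layer 1.\<close>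

primrec layer :: "('q, 'd, 'a, 'o, 'g) automaton \<Rightarrow> ('d, 'a, 'g, 'o) sigma_tree \<Rightarrow>
    ('d list \<times> 'q) set \<Rightarrow> nat \<Rightarrow> ('d list \<times> 'q) set" where
  "layer A t W 0 = {}"
| "layer A t W (Suc n) = {(u, q). \<exists>c. choice_ok A t u q c \<and>
     (\<forall>d q'. GMove (d, q') \<in> generators c \<longrightarrow> (u @ [d], q') \<in> W \<and>
        (q' \<in> accepting_states A \<or> (u @ [d], q') \<in> layer A t W n))}"

lemma layer_Suc: "layer A t W n \<subseteq> layer A t W (Suc n)"
proof (induction n)
  case (Suc n)
  show ?case
  proof
    fix p assume "p \<in> layer A t W (Suc n)"
    then show "p \<in> layer A t W (Suc (Suc n))"
      using Suc by (simp only: layer.simps(2)) blast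
  qed
qed simp

lemma layer_mono: "m \<le> n \<Longrightarrow> layer A t W m \<subseteq> layer A t W n"
  by (rule lift_Suc_mono_le[of "layer A t W"]) (rule layer_Suc)

text \<open>Finitely many moves leave a disjunct, so finite ranks suffice.\<close>

lemma layer_closed:
  assumes c: "choice_ok A t u q c"
    and mv: "\<And>d q'. GMove (d, q') \<in> generators c \<Longrightarrow> (u @ [d], q') \<in> W \<and>
        (q' \<in> accepting_states A \<or> (\<exists>n. (u @ [d], q') \<in> layer A t W n))"
  shows "\<exists>n. (u, q) \<in> layer A t W n"
proof -
  let ?M = "{(d, q'). GMove (d, q') \<in> generators c}"
  have "?M = GMove -` generators c" by auto
  then have fin: "finite ?M" by (simp add: finite_generators finite_vimageI inj_def)
  have "\<forall>p\<in>?M. \<exists>n. snd p \<in> accepting_states A \<or> (u @ [fst p], snd p) \<in> layer A t W n"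
    using mv by force
  then obtain N where N: "\<forall>p\<in>?M. snd p \<in> accepting_states A \<or>
      (u @ [fst p], snd p) \<in> layer A t W (N p)" by metis
  \<comment> \<open>The inserted 0 keeps \<open>Max\<close> meaningful when the disjunct has no
    moves.\<close>
  define m where "m = Max (insert 0 (N ` ?M))"
  have "layer A t W (N p) \<subseteq> layer A t W m" if "p \<in> ?M" for p
    using fin that unfolding m_def by (intro layer_mono Max_ge) auto
  then have "q' \<in> accepting_states A \<or> (u @ [d], q') \<in> layer A t W m"
    if "GMove (d, q') \<in> generators c" for d q'
    using N that by fastforce
  then have "(u, q) \<in> layer A t W (Suc m)" using c mv by (simp only: layer.simps(2)) blast
  then show ?thesis ..
qed

text \<open>Here histories with the same node and last state are merged.\<close>

definition positions :: "('q, 'd, 'a, 'o, 'g) automaton \<Rightarrow> ('d \<times> 'q) list set \<Rightarrow>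
    ('d list \<times> 'q) set" where
  "positions A V = (\<lambda>w. (map fst w, Last (init A, w))) ` V"

text \<open>An unranked word has an unranked extension by a non-accepting state, and iteration
  contradicts acceptance. The argument runs on words rather than positions, so that the infinite
  path obtained is one single history of the run.\<close>

lemma positions_in_layers:
  fixes A :: "('q::finite, 'd::finite, 'a, 'o, 'g) automaton"
  assumes A: "is_automaton x NP NF A" and run: "is_run_on x NP NF A t \<sigma>"
    and acc: "is_accepting x A \<sigma>" and w0: "w0 \<in> run_words A \<sigma>"
  defines "W \<equiv> positions A (run_words A \<sigma>)"
  shows "\<exists>n. (map fst w0, Last (init A, w0)) \<in> layer A t W n"
proof (rule ccontr)
  define bad where "bad w \<longleftrightarrow> w \<in> run_words A \<sigma> \<and>
      \<not> (\<exists>n. (map fst w, Last (init A, w)) \<in> layer A t W n)" for w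
  assume "\<not> ?thesis"
  then have bad0: "bad w0" using w0 by (simp add: bad_def)
  \<comment> \<open>Otherwise every move of the disjunct used by the run at \<open>w\<close> would
    be accepting or ranked, and \<open>layer_closed\<close> would rank \<open>w\<close>.\<close>
  have step: "\<exists>p. bad (w @ [p]) \<and> snd p \<notin> accepting_states A" if "bad w" for w
  proof (rule ccontr)
    assume no: "\<not> ?thesis"
    have w: "w \<in> run_words A \<sigma>" using that by (simp add: bad_def)
    from run_words_choice[OF A run w] obtain c where
      c: "choice_ok A t (map fst w) (Last (init A, w)) c" and
      mv: "\<And>d q. GMove (d, q) \<in> generators c \<Longrightarrow> w @ [(d, q)] \<in> run_words A \<sigma>" by blast
    have "\<exists>n. (map fst w, Last (init A, w)) \<in> layer A t W n"
    proof (rule layer_closed[OF c])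
      fix d q assume "GMove (d, q) \<in> generators c"
      from mv[OF this] have v: "w @ [(d, q)] \<in> run_words A \<sigma>" .
      then have "(map fst w @ [d], q) \<in> W"
        unfolding W_def positions_def by (intro image_eqI[OF _ v]) simp
      moreover have "q \<in> accepting_states A \<or> \<not> bad (w @ [(d, q)])" using no by force
      ultimately show "(map fst w @ [d], q) \<in> W \<and>
          (q \<in> accepting_states A \<or> (\<exists>n. (map fst w @ [d], q) \<in> layer A t W n))"
        using v by (auto simp: bad_def)
    qed
    then show False using that by (simp add: bad_def)
  qed
  define next_move where "next_move w = (SOME p. bad (w @ [p]) \<and> snd p \<notin> accepting_states A)" for w
  have nm: "bad (w @ [next_move w]) \<and> snd (next_move w) \<notin> accepting_states A" if "bad w" for w
    unfolding next_move_def using step[OF that] by (rule someI_ex)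
  define s where "s = rec_nat w0 (\<lambda>_ w. w @ [next_move w])"
  have s_simps: "s 0 = w0" "s (Suc n) = s n @ [next_move (s n)]" for n by (simp_all add: s_def)
  have s_bad: "bad (s n)" for n by (induction n) (use bad0 nm in \<open>auto simp: s_simps\<close>)
  have s_len: "length (s n) = length w0 + n" for n by (induction n) (auto simp: s_simps)
  have s_prefix: "prefix (s n) (s (n + k))" for n k
    by (induction k) (auto simp: s_simps)
  \<comment> \<open>Limit of the growing words: \<open>s (Suc n)\<close> has length above
    \<open>n\<close>, and later words keep its entries.\<close>
  define \<eta> where "\<eta> n = s (Suc n) ! n" for n
  have \<eta>: "\<eta> i = s n ! i" if i: "i < n" for i n
  proof -
    obtain k where "n = Suc i + k" using i by (auto simp: less_iff_Suc_add)
    then have "prefix (s (Suc i)) (s n)" using s_prefix[of "Suc i" k] by simp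
    then show ?thesis using s_len[of "Suc i"] by (auto simp: \<eta>_def prefix_def nth_append)
  qed
  have pre: "map \<eta> [0..<n] = take n (s n)" for n
    by (rule nth_equalityI) (auto simp: s_len \<eta>)
  have "map \<eta> [0..<n] \<in> run_words A \<sigma>" for n
  proof (rule run_words_append[OF A run])
    show "map \<eta> [0..<n] @ drop n (s n) \<in> run_words A \<sigma>"
      using s_bad[of n] by (simp add: pre bad_def)
  qed
  then have "hist_accepting A \<eta>" by (rule run_words_infinite[OF acc])
  \<comment> \<open>Beyond the length of \<open>w0\<close>, the last state of each prefix was
    supplied by \<open>next_move\<close>, which avoids accepting states.\<close>
  then obtain n where n: "n \<ge> Suc (length w0)" "Last (hist_prefix A \<eta> n) \<in> accepting_states A"
    unfolding hist_accepting_iff by blast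
  obtain k where k: "n = Suc (length w0 + k)" using n(1) by (auto simp: Suc_le_eq less_iff_Suc_add)
  have "map \<eta> [0..<n] = s (Suc k)"
  proof -
    have "prefix (s (Suc k)) (s n)" using s_prefix[of "Suc k" "length w0"] k by (simp add: add.commute)
    moreover have "length (s (Suc k)) = n" using s_len[of "Suc k"] k by simp
    ultimately show ?thesis unfolding pre by (auto simp: prefix_def)
  qed
  then have "Last (hist_prefix A \<eta> n) = snd (next_move (s k))"
    by (simp add: hist_prefix_def s_simps Last_def)
  then show False using n(2) nm[OF s_bad[of k]] by simp
qed

text \<open>A positional strategy with a progress measure for the Buechi condition. \<open>D\<close>
  is also total outside \<open>W\<close>, because a uniform run needs a disjunct for every state at
  every node.\<close>

definition ranked_strategy :: "('q, 'd, 'a, 'o, 'g) automaton \<Rightarrow> ('d, 'a, 'g, 'o) sigma_tree \<Rightarrow>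
    ('d list \<times> 'q) set \<Rightarrow> ('d list \<times> 'q \<Rightarrow> nat) \<Rightarrow>
    ('d list \<Rightarrow> 'q \<Rightarrow> ('a, 'o, 'd, 'g, 'd \<times> 'q) gen fm) \<Rightarrow> bool" where
  "ranked_strategy A t W rk D \<longleftrightarrow> ([], init A) \<in> W \<and>
     (\<forall>u q. D u q \<in> disjuncts (delta A q)) \<and>
     (\<forall>(u, q)\<in>W. choice_ok A t u q (D u q) \<and>
        (\<forall>d q'. GMove (d, q') \<in> generators (D u q) \<longrightarrow> (u @ [d], q') \<in> W \<and>
           (q' \<in> accepting_states A \<or> rk (u @ [d], q') < rk (u, q))))"

lemma ranked_strategy_exists:
  fixes A :: "('q::finite, 'd::finite, 'a, 'o, 'g) automaton"
  assumes A: "is_automaton x NP NF A" and run: "is_run_on x NP NF A t \<sigma>"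
    and acc: "is_accepting x A \<sigma>"
  shows "\<exists>W rk D. ranked_strategy A t W rk D"
proof -
  define W where "W = positions A (run_words A \<sigma>)"
  have lay: "\<exists>n. p \<in> layer A t W n" if "p \<in> W" for p
    using that positions_in_layers[OF A run acc] by (auto simp: W_def positions_def)
  define rk where "rk p = (LEAST n. p \<in> layer A t W n)" for p
  have rk: "p \<in> layer A t W (rk p)" if "p \<in> W" for p
    unfolding rk_def using lay[OF that] by (rule LeastI_ex)
  define good where "good u q c \<longleftrightarrow> choice_ok A t u q c \<and>
      (\<forall>d q'. GMove (d, q') \<in> generators c \<longrightarrow> (u @ [d], q') \<in> W \<and>
        (q' \<in> accepting_states A \<or> rk (u @ [d], q') < rk (u, q)))" for u q c
  have ex: "\<exists>c. good u q c" if uq: "(u, q) \<in> W" for u q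
  proof -
    have in_layer: "(u, q) \<in> layer A t W (rk (u, q))" using rk[OF uq] .
    \<comment> \<open>Layer 0 is empty, so ranks are positive; the disjunct witnessing layer
      \<open>Suc m\<close> leads to accepting states or to ranks at most \<open>m\<close>.\<close>
    then obtain m where m: "rk (u, q) = Suc m" by (cases "rk (u, q)") auto
    have "rk p < rk (u, q)" if "p \<in> layer A t W m" for p
      using that m by (simp add: rk_def Least_le less_Suc_eq_le)
    then show ?thesis using in_layer unfolding m good_def by fastforce
  qed
  have "\<exists>c. c \<in> disjuncts (delta A q) \<and> ((u, q) \<in> W \<longrightarrow> good u q c)" for u q
  proof (cases "(u, q) \<in> W")
    case True
    then show ?thesis using ex[OF True] by (auto simp: good_def choice_ok_def)
  next
    case False
    then show ?thesis using disjuncts_nonempty[of "delta A q"] by blast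
  qed
  \<comment> \<open>Choice is applied first over states and then over nodes, which gives the curried
    form of \<open>D\<close>.\<close>
  then have "\<forall>u. \<exists>Du. \<forall>q. Du q \<in> disjuncts (delta A q) \<and> ((u, q) \<in> W \<longrightarrow> good u q (Du q))"
    by (intro allI choice) blast
  from choice[OF this] obtain D where "\<forall>u q. D u q \<in> disjuncts (delta A q) \<and> ((u, q) \<in> W \<longrightarrow> good u q (D u q))"
    by blast
  moreover have "([], init A) \<in> W" unfolding W_def positions_def
    by (rule image_eqI[OF _ run_words_Nil[OF run]]) (simp add: Last_def)
  ultimately have "ranked_strategy A t W rk D" unfolding ranked_strategy_def good_def by blast
  then show ?thesis by blast
qed

section \<open>The tree of plays of a positional strategy as a uniform accepting run\<close>

section \<open>The run of a positional strategy\<close>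

inductive follows :: "('q, 'd, 'a, 'o, 'g) automaton \<Rightarrow>
    ('d list \<Rightarrow> 'q \<Rightarrow> ('a, 'o, 'd, 'g, 'd \<times> 'q) gen fm) \<Rightarrow> ('d \<times> 'q) list \<Rightarrow> bool"
  for A D where
  Nil: "follows A D []"
| snoc: "follows A D w \<Longrightarrow> GMove (d, q) \<in> generators (D (map fst w) (Last (init A, w))) \<Longrightarrow>
    follows A D (w @ [(d, q)])"

lemma follows_snoc_iff: "follows A D (w @ [(d, q)]) \<longleftrightarrow>
    follows A D w \<and> GMove (d, q) \<in> generators (D (map fst w) (Last (init A, w)))"
  by (auto intro: follows.snoc elim: follows.cases)

definition strategy_hists where
  "strategy_hists A D u = {(init A, w) | w. follows A D w \<and> map fst w = u}"

definition strategy_gens where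
  "strategy_gens A D u = (\<Union>h\<in>strategy_hists A D u. dist_gen h ` generators (D u (Last h)))"

definition strategy_run :: "('q, 'd, 'a, 'o, 'g) automaton \<Rightarrow>
    ('d list \<Rightarrow> 'q \<Rightarrow> ('a, 'o, 'd, 'g, 'd \<times> 'q) gen fm) \<Rightarrow> ('q, 'd, 'a, 'o, 'g) run_tree" where
  "strategy_run A D u = (if strategy_hists A D u = {} then None
     else Some \<lparr>hists = strategy_hists A D u, lits = {l. GLit l \<in> strategy_gens A D u},
       constrs = {c. GCon c \<in> strategy_gens A D u}\<rparr>)"

lemma dom_strategy_run: "u \<in> dom (strategy_run A D) \<longleftrightarrow> strategy_hists A D u \<noteq> {}"
  by (simp add: strategy_run_def domIff)

lemma strategy_run_sel:
  assumes "u \<in> dom (strategy_run A D)"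
  shows "Y_of (strategy_run A D) u = strategy_hists A D u"
    "L_of (strategy_run A D) u = {l. GLit l \<in> strategy_gens A D u}"
    "X_of (strategy_run A D) u = {c. GCon c \<in> strategy_gens A D u}"
  using assms by (auto simp: strategy_run_def Y_of_def L_of_def X_of_def split: if_splits)

text \<open>Both sides consist of the plays reaching \<open>u\<close>, extended by a move in
  direction \<open>d\<close> that \<open>D\<close> prescribes. This gives the successor condition of
  a run.\<close>

lemma strategy_hists_snoc:
  fixes A :: "('q, 'd, 'a, 'o, 'g) automaton"
  shows "succ_hists A (length u) (strategy_gens A D u) d = strategy_hists A D (u @ [d])"
proof -
  have "map fst v = u @ [d] \<longleftrightarrow> (\<exists>w q. v = w @ [(d, q)] \<and> map fst w = u)" for v :: "('d \<times> 'q) list"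
    by (cases v rule: rev_cases) auto
  then have "h \<in> strategy_hists A D (u @ [d]) \<longleftrightarrow> (\<exists>w q. h = (init A, w @ [(d, q)]) \<and>
      follows A D (w @ [(d, q)]) \<and> map fst w = u)" for h
    by (auto simp: strategy_hists_def)
  then show ?thesis
    by (fastforce simp: succ_hists_def strategy_gens_def strategy_hists_def follows_snoc_iff
        Hist_def image_iff)
qed

lemma node_follows_strategy:
  assumes "u \<in> dom (strategy_run A D)"
  shows "node_follows A (strategy_run A D) u (strategy_gens A D u)"
  using strategy_run_sel[OF assms] strategy_run_sel(1)[of "u @ [_]" A D]
  by (simp add: node_follows_def strategy_hists_snoc dom_strategy_run)

text \<open>Plays reaching \<open>u\<close> are words of length \<open>length u\<close> over a
  finite alphabet. Finiteness allows the listing that \<open>is_conj_over\<close> asks for.\<close>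

lemma finite_strategy_hists:
  fixes A :: "('q::finite, 'd::finite, 'a, 'o, 'g) automaton"
  shows "finite (strategy_hists A D u)"
proof (rule finite_subset)
  show "strategy_hists A D u \<subseteq> {init A} \<times> {w. set w \<subseteq> UNIV \<and> length w = length u}"
    by (auto simp: strategy_hists_def)
qed (intro finite_cartesian_product finite_lists_length_eq; simp)

text \<open>A play reaching a successor comes from a generator at the parent, hence from a play
  reaching the parent.\<close>

lemma is_partial_tree_strategy_run: "is_partial_tree (strategy_run A D)"
proof -
  have "u \<in> dom (strategy_run A D)" if "u @ v \<in> dom (strategy_run A D)" for u v
    using that
  proof (induction v rule: rev_induct)
    case (snoc d v)
    then have "strategy_hists A D ((u @ v) @ [d]) \<noteq> {}" by (simp add: dom_strategy_run)
    then have "strategy_gens A D (u @ v) \<noteq> {}"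
      unfolding strategy_hists_snoc[symmetric] by (auto simp: succ_hists_def)
    then show ?case using snoc.IH by (auto simp: strategy_gens_def dom_strategy_run)
  qed simp
  then show ?thesis by (auto simp: is_partial_tree_def prefix_def)
qed

text \<open>Giving the variable \<open>(u, g)\<close> the value of \<open>g\<close> at node
  \<open>u\<close> of \<open>t\<close> turns each shifted constraint into an instance of
  \<open>constr_holds\<close>.\<close>

lemma csp_consistent_if_constr_holds:
  assumes t: "is_sigma_tree x NP NF t" and lab: "is_run_labelling x NP NF A \<sigma>"
    and X: "\<forall>u\<in>dom \<sigma>. \<forall>c\<in>X_of \<sigma> u. constr_holds t u c"
  shows "csp_consistent x \<sigma>"
  unfolding csp_consistent_def
proof (intro exI[of _ "\<lambda>(u, g). snd (t u) g"] ballI, clarify)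
  fix P vs assume "(P, vs) \<in> csp \<sigma>"
  then obtain us v where vs: "vs = shift_vars v us" and v: "v \<in> dom \<sigma>"
    and c: "Constr P us \<in> X_of \<sigma> v"
    by (auto simp: csp_def)
  have g: "g \<in> NF" if "(w, g) \<in> set us" for w g
    using lab v c that by (force simp: is_run_labelling_def Constr_of_def)
  have "snd (t u) g \<in> objs x" if "g \<in> NF" for u g
    using t that unfolding is_sigma_tree_def by (metis PiE_mem mem_Times_iff)
  then have "(\<lambda>(u, g). snd (t u) g) ` set vs \<subseteq> objs x" using g by (auto simp: vs shift_vars_def)
  moreover have "map (\<lambda>(u, g). snd (t u) g) vs = map (\<lambda>(w, g). snd (t (v @ w)) g) us"
    by (auto simp: vs shift_vars_def)
  moreover have "constr_holds t v (Constr P us)" using X v c by blast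
  ultimately show "(\<lambda>(u, g). snd (t u) g) ` set vs \<subseteq> objs x \<and>
      map (\<lambda>(u, g). snd (t u) g) vs \<in> \<Union>P"
    by simp
qed

text \<open>From here on the original run is forgotten; only the ranked strategy extracted from it
  remains.\<close>

locale positional_strategy =
  fixes x :: "'o spatial_alg" and NP :: "'a set" and NF :: "'g set"
    and A :: "('q::finite, 'd::finite, 'a, 'o, 'g) automaton"
    and t :: "('d, 'a, 'g, 'o) sigma_tree"
    and W rk D
  assumes automaton: "is_automaton x NP NF A"
    and tree: "is_sigma_tree x NP NF t"
    and ranked: "ranked_strategy A t W rk D"
begin

lemma D_disjunct: "D u q \<in> disjuncts (delta A q)"
  using ranked by (simp add: ranked_strategy_def)

lemma D_move:
  assumes "(u, q) \<in> W" "GMove (d, q') \<in> generators (D u q)"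
  shows "(u @ [d], q') \<in> W" "q' \<notin> accepting_states A \<Longrightarrow> rk (u @ [d], q') < rk (u, q)"
  using ranked assms unfolding ranked_strategy_def by blast+

lemma follows_in_W: "follows A D w \<Longrightarrow> (map fst w, Last (init A, w)) \<in> W"
proof (induction rule: follows.induct)
  case Nil
  then show ?case using ranked by (simp add: ranked_strategy_def Last_def)
next
  case (snoc w d q)
  then show ?case using D_move(1) by simp
qed

text \<open>Plays of \<open>D\<close> never leave \<open>W\<close>, and inside \<open>W\<close> the
  choices of \<open>D\<close> are legal.\<close>

lemma strategy_gens_hold:
  shows "GLit l \<in> strategy_gens A D u \<Longrightarrow> lit_holds t u l"
    and "GCon k \<in> strategy_gens A D u \<Longrightarrow> constr_holds t u k"
proof -
  have ok: "choice_ok A t u (Last h) (D u (Last h))" if "h \<in> strategy_hists A D u" for h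
    using that follows_in_W ranked unfolding ranked_strategy_def strategy_hists_def by blast
  show "GLit l \<in> strategy_gens A D u \<Longrightarrow> lit_holds t u l"
    "GCon k \<in> strategy_gens A D u \<Longrightarrow> constr_holds t u k"
    using ok by (auto simp: strategy_gens_def choice_ok_def image_iff)
qed

lemma strategy_gens_labels:
  shows "GLit l \<in> strategy_gens A D u \<Longrightarrow> l \<in> Lit_of NP"
    and "GCon k \<in> strategy_gens A D u \<Longrightarrow> k \<in> Constr_of x NF"
proof -
  have "generators (D u q) \<subseteq> GLit ` Lit_of NP \<union> GCon ` Constr_of x NF \<union> range GMove" for q
    using generators_disjunct[OF D_disjunct] automaton unfolding is_automaton_def by blast
  then show "GLit l \<in> strategy_gens A D u \<Longrightarrow> l \<in> Lit_of NP"
    "GCon k \<in> strategy_gens A D u \<Longrightarrow> k \<in> Constr_of x NF"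
    by (auto simp: strategy_gens_def image_iff subset_iff; blast)+
qed

lemma is_run_labelling_strategy_run: "is_run_labelling x NP NF A (strategy_run A D)"
proof -
  \<comment> \<open>No complementary pair can occur, since all these literals hold at the same node
    of \<open>t\<close>.\<close>
  have "{l. GLit l \<in> strategy_gens A D u} \<in> consistent_lits NP" for u
    using strategy_gens_labels(1) strategy_gens_hold(1)[of "Pos _" u] strategy_gens_hold(1)[of "Neg _" u]
    by (auto simp: consistent_lits_def)
  then show ?thesis using strategy_gens_labels(2)
    by (auto simp: is_run_labelling_def strategy_run_sel strategy_hists_def Hist_fin_def Hist_def)
qed

lemma is_run_on_strategy_run: "is_run_on x NP NF A t (strategy_run A D)"
proof -
  have Nil: "strategy_hists A D [] = {(init A, [])}"
    by (auto simp: strategy_hists_def intro: follows.Nil)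
  have node: "\<exists>e. is_conj_over (Y_of (strategy_run A D) u) (\<lambda>h. dist h (delta A (Last h))) e \<and>
      (\<exists>c\<in>disjuncts (dnf e). node_follows A (strategy_run A D) u (generators c))"
    if u: "u \<in> dom (strategy_run A D)" for u
  proof -
    obtain hs where hs: "set hs = strategy_hists A D u" "distinct hs"
      using finite_distinct_list[OF finite_strategy_hists] by blast
    have ne: "hs \<noteq> []" using u hs by (auto simp: dom_strategy_run)
    have "is_dnf (delta A q)" for q using automaton by (simp add: is_automaton_def)
    \<comment> \<open>Positional picks are in particular picks per history, so they assemble to one
      disjunct of the normal form.\<close>
    then have "\<forall>h\<in>set hs. dist h (D u (Last h)) \<in> disjuncts (dnf (dist h (delta A (Last h))))"
      using D_disjunct by (simp add: dist_def dnf_is_dnf is_dnf_map_fm disjuncts_map_fm)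
    from disjunct_dnf_And_listI[OF ne this] obtain c where
      c: "c \<in> disjuncts (dnf (And_list (map (\<lambda>h. dist h (delta A (Last h))) hs)))"
      and "generators c = strategy_gens A D u"
      by (auto simp: generators_dist strategy_gens_def hs)
    then have "node_follows A (strategy_run A D) u (generators c)"
      using node_follows_strategy[OF u] by simp
    then show ?thesis using c ne hs strategy_run_sel(1)[OF u] unfolding is_conj_over_def by blast
  qed
  show ?thesis
    unfolding is_run_on_def
    using is_partial_tree_strategy_run is_run_labelling_strategy_run node strategy_gens_hold
    by (auto simp: strategy_run_sel dom_strategy_run Nil)
qed

text \<open>At node \<open>u\<close> the witness is \<open>D u\<close>, which sees a history only
  through its last state.\<close>

lemma is_uniform_run_strategy_run: "is_uniform_run x NP NF A (strategy_run A D)"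
  unfolding is_uniform_run_def
proof (intro conjI ballI)
  show "is_run x NP NF A (strategy_run A D)"
    using tree is_run_on_strategy_run by (auto simp: is_run_def)
  fix u assume u: "u \<in> dom (strategy_run A D)"
  obtain hs where hs: "set hs = strategy_hists A D u" "distinct hs"
    using finite_distinct_list[OF finite_strategy_hists] by blast
  have ne: "hs \<noteq> []" using u hs by (auto simp: dom_strategy_run)
  let ?e = "And_list (map (\<lambda>h. dist h (D u (Last h))) hs)"
  have "is_conj_over (Y_of (strategy_run A D) u) (\<lambda>h. dist h (D u (Last h))) ?e"
    using ne hs strategy_run_sel(1)[OF u] unfolding is_conj_over_def by blast
  moreover have "generators ?e = strategy_gens A D u"
    using ne by (simp add: generators_And_list generators_dist strategy_gens_def hs)
  ultimately show "\<exists>D'. (\<forall>q. D' q \<in> disjuncts (delta A q)) \<and>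
      (\<exists>e. is_conj_over (Y_of (strategy_run A D) u) (\<lambda>h. dist h (D' (Last h))) e \<and>
        node_follows A (strategy_run A D) u (generators e))"
    using D_disjunct node_follows_strategy[OF u] by (intro exI[of _ "D u"]) auto
qed

text \<open>Each history along a branch is a play of \<open>D\<close>. Were it to avoid accepting
  states from some level on, its ranks would descend forever.\<close>

lemma is_accepting_strategy_run: "is_accepting x A (strategy_run A D)"
  unfolding is_accepting_def
proof (intro conjI allI impI)
  show "csp_consistent x (strategy_run A D)"
    by (rule csp_consistent_if_constr_holds[OF tree is_run_labelling_strategy_run])
      (auto simp: strategy_run_sel strategy_gens_hold)
  fix \<beta> \<eta>
  assume "is_branch (strategy_run A D) \<beta>" "hist_along A (strategy_run A D) \<beta> \<eta>"
  \<comment> \<open>\<open>hist_along\<close> constrains only levels from 1 on, so the empty prefix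
    is treated separately.\<close>
  then have fol: "follows A D (map \<eta> [0..<n])" for n
    by (cases "n = 0") (auto simp: is_branch_def hist_along_def hist_prefix_def strategy_run_sel
        strategy_hists_def intro: follows.Nil)
  let ?p = "\<lambda>n. (map fst (map \<eta> [0..<n]), Last (hist_prefix A \<eta> n))"
  have desc: "rk (?p (Suc n)) < rk (?p n)"
    if "Last (hist_prefix A \<eta> (Suc n)) \<notin> accepting_states A" for n
  proof -
    have "GMove (\<eta> n) \<in> generators (D (map fst (map \<eta> [0..<n])) (Last (hist_prefix A \<eta> n)))"
      using fol[of "Suc n"] follows_snoc_iff[of A D "map \<eta> [0..<n]" "fst (\<eta> n)" "snd (\<eta> n)"]
      by (simp add: hist_prefix_def)
    then show ?thesis
      using D_move(2)[OF follows_in_W[OF fol[of n]], of "fst (\<eta> n)" "snd (\<eta> n)"] that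
      by (simp add: hist_prefix_def Last_def)
  qed
  show "hist_accepting A \<eta>"
  proof (rule ccontr)
    assume "\<not> hist_accepting A \<eta>"
    then obtain N where N: "\<forall>n\<ge>N. Last (hist_prefix A \<eta> n) \<notin> accepting_states A"
      by (auto simp: hist_accepting_iff)
    \<comment> \<open>The shift by \<open>N\<close> starts the sequence where the accepting states
      have ceased, so every step of it descends.\<close>
    define f where "f i = rk (?p (N + i))" for i
    have "f (Suc i) < f i" for i using desc[of "N + i"] N by (simp add: f_def)
    then show False using wf_no_infinite_down_chainE[OF wf_less_than, of f] by (metis less_than_iff)
  qed
qed

end

theorem theorem1:
  fixes x :: "'o spatial_alg"
    and NP :: "'a set"
    and NF :: "'g set"
    and A :: "('q::finite, 'd::finite, 'a, 'o, 'g) automaton"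
    and t :: "('d, 'a, 'g, 'o) sigma_tree"
  assumes "spatial_relation_algebra x"
    and "finite NF"
    and "is_automaton x NP NF A"
    and "is_sigma_tree x NP NF t"
    and "accepts x NP NF A t"
  shows "\<exists>\<sigma>. is_run_on x NP NF A t \<sigma> \<and> is_accepting x A \<sigma> \<and> is_uniform_run x NP NF A \<sigma>"
proof -
  from assms(5) obtain \<sigma> where "is_run_on x NP NF A t \<sigma>" "is_accepting x A \<sigma>"
    by (auto simp: accepts_def)
  from ranked_strategy_exists[OF assms(3) this] obtain W rk D where "ranked_strategy A t W rk D"
    by blast
  then interpret positional_strategy x NP NF A t W rk D
    using assms by unfold_locales
  show ?thesis
    using is_run_on_strategy_run is_accepting_strategy_run is_uniform_run_strategy_run by blast
qed

end
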